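(* Let $p\geq 1$ be an integer and let $x$ be a (real or formal) parameter. Let $\Omega_n^{(p)}(y)$, $n\ge 0$, be the monic orthogonal polynomials with respect to the sequence $\left(E_k^{(p)}(x)\right)_{k\ge0}$. Then $\Omega_0^{(p)}(y)=1$, $\Omega_1^{(p)}(y)=y-x+\frac{p}{2}$, and for all $n\geq 1$, \[ \Omega_{n+1}^{(p)}(y)=\left(y-x+\frac{p}{2}\right)\Omega_n^{(p)}(y)+\frac{n(n+p-1)}{4}\,\Omega_{n-1}^{(p)}(y). \]
   Context: The higher-order Euler polynomials $E_n^{(p)}(x)$ are defined by the generating function \[ \left(\frac{2}{e^{z}+1}\right)^{p}e^{xz}=\sum_{n=0}^{\infty}E_{n}^{(p)}(x)\frac{z^{n}}{n!}. \] Given a sequence $(m_k)_{k\ge0}$, the monic orthogonal polynomials with respect to $(m_k)$ are the monic polynomials $P_n(y)$ with $\deg P_n=n$ such that for all integers $0\le r<n$, \[ y^{r}P_{n}(y)\big|_{y^{k}=m_{k}}=0, \] where the left-hand side means: expand $y^rP_n(y)$ as a polynomial in $y$ and replace each power $y^k$ by $m_k$. Here $\Omega_n^{(p)}$ are these polynomials for $m_k=E_k^{(p)}(x)$. *)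

theory Defs
  imports "HOL-Computational_Algebra.Computational_Algebra"
begin

text \<open>
  The parameter \<open>x\<close> ranges over an arbitrary field of characteristic 0. This covers real \<open>x\<close>
  as well as an indeterminate \<open>x\<close>, viewed as an element of a field of rational functions.
  In \<open>higher_euler p n x\<close>, \<open>p\<close> is the order and \<open>n\<close> the degree of \<open>E\<^sub>n\<^sup>(\<^sup>p\<^sup>)(x)\<close>; the division is exact because
  \<open>e\<^sup>z + 1\<close> has the invertible constant term 2.
\<close>

definition higher_euler :: "nat \<Rightarrow> nat \<Rightarrow> 'a::field_char_0 \<Rightarrow> 'a" where
  "higher_euler p n x = fact n * fps_nth ((2 / (fps_exp 1 + 1)) ^ p * fps_exp x) n"

text \<open>The linear functional on polynomials in \<open>y\<close> that replaces each power \<open>y ^ k\<close> by \<open>m k\<close>.\<close>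

definition umbral_eval :: "(nat \<Rightarrow> 'a::comm_ring_1) \<Rightarrow> 'a poly \<Rightarrow> 'a" where
  "umbral_eval m q = (\<Sum>k\<le>degree q. coeff q k * m k)"

definition monic_orthogonal :: "(nat \<Rightarrow> 'a::comm_ring_1) \<Rightarrow> (nat \<Rightarrow> 'a poly) \<Rightarrow> bool" where
  "monic_orthogonal m P \<longleftrightarrow>
     (\<forall>n. degree (P n) = n \<and> lead_coeff (P n) = 1 \<and>
          (\<forall>r<n. umbral_eval m (monom 1 r * P n) = 0))"

end

theory Submission
  imports Defs
begin

text \<open>
  Write \<open>L\<close> for the functional \<open>y ^ k \<mapsto> m k\<close> and \<open>F\<close> for the exponential generating function of \<open>m\<close>.
  Then \<open>L (y ^ r q(y))\<close> is the \<open>r\<close>-th Taylor coefficient (times \<open>r!\<close>) of \<open>q(D) F\<close>, \<open>D = d/dz\<close>, so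
  orthogonality of \<open>P\<^sub>n\<close> says that \<open>P\<^sub>n(D) F\<close> vanishes to order \<open>n\<close> at 0. With \<open>u = tanh (z/2)\<close> one has
  \<open>2 / (e\<^sup>z + 1) = 1 - u\<close> and \<open>u' = (1 - u\<^sup>2) / 2\<close>, hence
  \<open>(D - x + p/2) (F u\<^sup>n) = F (n u\<^sup>n\<^sup>-\<^sup>1 - (n + p) u\<^sup>n\<^sup>+\<^sup>1) / 2\<close>. Therefore the polynomials \<open>W\<^sub>n\<close>
  defined by the claimed recurrence satisfy \<open>W\<^sub>n(D) F = c\<^sub>n F u\<^sup>n\<close> with \<open>c\<^sub>n = (-1/2)\<^sup>n p (p+1) \<dots> (p+n-1)\<close>.
  They are orthogonal, and since \<open>c\<^sub>n \<noteq> 0\<close> they are the only monic orthogonal polynomials.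
\<close>

section \<open>The functional, and uniqueness of monic orthogonal polynomials\<close>

lemma umbral_eval_eq_sum:
  assumes "degree q \<le> N"
  shows "umbral_eval m q = (\<Sum>k\<le>N. coeff q k * m k)"
  unfolding umbral_eval_def
  by (rule sum.mono_neutral_left) (use assms in \<open>auto simp: coeff_eq_0\<close>)

lemma umbral_eval_0 [simp]: "umbral_eval m 0 = 0"
  by (simp add: umbral_eval_def)

lemma umbral_eval_monom [simp]: "umbral_eval m (monom c n) = c * m n"
  by (subst umbral_eval_eq_sum[OF degree_monom_le]) (simp add: if_distrib[of "\<lambda>a. a * _"] cong: if_cong)

lemma umbral_eval_add: "umbral_eval m (p + q) = umbral_eval m p + umbral_eval m q"
  by (simp add: umbral_eval_eq_sum[of _ "max (degree p) (degree q)"] degree_add_le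
      sum.distrib algebra_simps)

lemma umbral_eval_smult: "umbral_eval m (smult c q) = c * umbral_eval m q"
  by (simp add: umbral_eval_eq_sum[of _ "degree q"] degree_smult_le sum_distrib_left mult.assoc)

lemma umbral_eval_diff: "umbral_eval m (p - q) = umbral_eval m p - umbral_eval m q"
  using umbral_eval_add[of m "p - q" q] by simp

lemma umbral_eval_sum: "umbral_eval m (\<Sum>i\<in>A. f i) = (\<Sum>i\<in>A. umbral_eval m (f i))"
  by (induction A rule: infinite_finite_induct) (simp_all add: umbral_eval_add)

text \<open>Expand \<open>q\<close> in powers of y: orthogonality annihilates every term below y^n,
  so only the top coefficient can survive.\<close>

lemma umbral_eval_mult_orthogonal:
  assumes "monic_orthogonal m P" and "degree q \<le> n"
  shows "umbral_eval m (q * P n) = coeff q n * umbral_eval m (monom 1 n * P n)"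
proof -
  have "q * P n = (\<Sum>i\<le>n. smult (coeff q i) (monom 1 i * P n))"
    by (subst poly_as_sum_of_monoms'[OF assms(2), symmetric])
      (simp add: sum_distrib_right smult_monom flip: mult_smult_left)
  then have "umbral_eval m (q * P n) = (\<Sum>i\<le>n. coeff q i * umbral_eval m (monom 1 i * P n))"
    by (simp add: umbral_eval_sum umbral_eval_smult)
  also have "\<dots> = (\<Sum>i\<in>{n}. coeff q i * umbral_eval m (monom 1 i * P n))"
    by (rule sum.mono_neutral_right) (use assms(1) in \<open>auto simp: monic_orthogonal_def\<close>)
  finally show ?thesis by simp
qed

text \<open>If \<open>d = Q n - P n\<close> is nonzero, monicity gives it a degree j < n. Pairing
  \<open>d\<close> with \<open>P j\<close> yields its leading coefficient times a value that is
  nonzero by hypothesis; but both \<open>Q n\<close> and \<open>P n\<close> are orthogonal to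
  \<open>P j\<close>, a contradiction.\<close>

lemma monic_orthogonal_unique:
  fixes m :: "nat \<Rightarrow> 'a::idom"
  assumes P: "monic_orthogonal m P" and Q: "monic_orthogonal m Q"
    and nz: "\<And>n. umbral_eval m (monom 1 n * P n) \<noteq> 0"
  shows "P = Q"
proof
  fix n
  define d where "d = Q n - P n"
  have deg: "degree (P k) = k" "coeff (P k) k = 1" "degree (Q k) = k" "coeff (Q k) k = 1" for k
    using P Q unfolding monic_orthogonal_def by metis+
  show "P n = Q n"
  proof (rule ccontr)
    assume "P n \<noteq> Q n"
    then have "d \<noteq> 0" by (simp add: d_def)
    have "degree d \<le> n" unfolding d_def by (intro degree_diff_le) (simp_all add: deg)
    moreover have "coeff d n = 0" by (simp add: d_def deg)
    ultimately have less: "degree d < n"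
      using \<open>d \<noteq> 0\<close> by (metis leading_coeff_0_iff le_neq_implies_less)
    let ?j = "degree d"
    have "lead_coeff d * umbral_eval m (monom 1 ?j * P ?j) = umbral_eval m (d * P ?j)"
      by (simp add: umbral_eval_mult_orthogonal[OF P])
    also have "\<dots> = umbral_eval m (P ?j * Q n) - umbral_eval m (P ?j * P n)"
      by (simp add: d_def umbral_eval_diff[symmetric] algebra_simps)
    also have "\<dots> = 0"
      using less by (simp add: umbral_eval_mult_orthogonal[OF P] umbral_eval_mult_orthogonal[OF Q]
          deg coeff_eq_0)
    finally show False using nz \<open>d \<noteq> 0\<close> by simp
  qed
qed

text \<open>The series \<open>q(D) F\<close>, where \<open>F\<close> is the exponential generating function of \<open>m\<close>.\<close>

definition umbral_fps :: "(nat \<Rightarrow> 'a::field_char_0) \<Rightarrow> 'a poly \<Rightarrow> 'a fps" where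
  "umbral_fps m q = Abs_fps (\<lambda>n. umbral_eval m (monom 1 n * q) / fact n)"

lemma umbral_fps_add: "umbral_fps m (p + q) = umbral_fps m p + umbral_fps m q"
  by (simp add: umbral_fps_def fps_eq_iff umbral_eval_add distrib_left add_divide_distrib)

lemma umbral_fps_smult: "umbral_fps m (smult c q) = fps_const c * umbral_fps m q"
  by (simp add: umbral_fps_def fps_eq_iff umbral_eval_smult)

text \<open>A factor y raises the index of each moment by one, which is differentiation of an
  exponential generating function.\<close>

lemma umbral_fps_pCons_0: "umbral_fps m (pCons 0 q) = fps_deriv (umbral_fps m q)"
proof (rule fps_ext)
  fix n
  have "monom 1 n * pCons 0 q = monom 1 (Suc n) * q"
    by (simp add: monom_Suc)
  moreover have "(1 + of_nat n :: 'a) \<noteq> 0"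
    by (metis of_nat_Suc of_nat_neq_0)
  ultimately show "umbral_fps m (pCons 0 q) $ n = fps_deriv (umbral_fps m q) $ n"
    by (simp add: umbral_fps_def fps_deriv_nth fact_Suc del: of_nat_Suc)
qed

lemma umbral_fps_1: "umbral_fps (\<lambda>n. fact n * F $ n) 1 = F"
  by (simp add: umbral_fps_def fps_eq_iff)

text \<open>Up to factorials, the coefficients below order n are the pairings with y^r for r <
  n.\<close>

lemma monic_orthogonalI_subdegree:
  assumes "\<And>n. degree (P n) = n" "\<And>n. lead_coeff (P n) = 1"
    and "\<And>n. subdegree (umbral_fps m (P n)) = n"
  shows "monic_orthogonal m P"
proof -
  have "umbral_eval m (monom 1 r * P n) = 0" if "r < n" for r n
    using nth_less_subdegree_zero[of r "umbral_fps m (P n)"] that assms(3)[of n]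
    by (simp add: umbral_fps_def)
  then show ?thesis using assms unfolding monic_orthogonal_def by blast
qed

section \<open>The series tanh (z/2)\<close>

definition fps_tanh_half :: "'a::field_char_0 fps" where
  "fps_tanh_half = 1 - 2 / (fps_exp 1 + 1)"

lemma two_div_fps_exp_plus_1: "2 / (fps_exp 1 + 1) = 1 - fps_tanh_half"
  by (simp add: fps_tanh_half_def)

text \<open>With v = 1/(e^z + 1) one has e^z v = 1 - v, so v' = v^2 - v. Since u = 1 - 2v, both
  sides equal 2 (v - v^2).\<close>

lemma fps_deriv_tanh_half:
  "fps_deriv (fps_tanh_half :: 'a::field_char_0 fps) = fps_const (1 / 2) * (1 - fps_tanh_half ^ 2)"
proof -
  define E :: "'a fps" where "E = fps_exp 1"
  define v where "v = inverse (E + 1)"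
  have nz: "(E + 1) $ 0 \<noteq> 0" by (simp add: E_def)
  have Ev: "E * v = 1 - v"
    using inverse_mult_eq_1'[OF nz] by (simp add: v_def algebra_simps)
  have u: "fps_tanh_half = 1 - 2 * v"
    using nz by (simp add: fps_tanh_half_def v_def E_def[symmetric] fps_divide_unit)
  have "fps_deriv v = - E * v ^ 2"
    using nz by (simp add: v_def fps_inverse_deriv E_def)
  also have "\<dots> = - (E * v) * v" by (simp add: power2_eq_square)
  also have "\<dots> = v ^ 2 - v" by (simp add: Ev power2_eq_square algebra_simps)
  finally have "fps_deriv v = v ^ 2 - v" .
  then have "fps_deriv fps_tanh_half = 2 * (v - v ^ 2)" by (simp add: u right_diff_distrib)
  moreover have "fps_const (1 / 2) * (1 - fps_tanh_half ^ 2) = (fps_const (1 / 2) * 2) * 2 * (v - v ^ 2)"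
    by (simp add: u power2_eq_square algebra_simps)
  moreover have "fps_const (1 / 2) * 2 = (1 :: 'a fps)"
    by (simp add: numeral_fps_const)
  ultimately show ?thesis by (simp only: mult_1_left)
qed

text \<open>The differential equation and u(0) = 0 give the linear coefficient 1/2.\<close>

lemma subdegree_tanh_half: "subdegree (fps_tanh_half :: 'a::field_char_0 fps) = 1"
proof (rule subdegreeI)
  have 0: "(fps_tanh_half :: 'a fps) $ 0 = 0"
    by (simp add: fps_tanh_half_def fps_divide_unit)
  then show "(fps_tanh_half :: 'a fps) $ i = 0" if "i < 1" for i
    using that by simp
  have "fps_deriv fps_tanh_half $ 0 = (1 / 2 :: 'a)"
    by (simp add: fps_deriv_tanh_half 0)
  then show "(fps_tanh_half :: 'a fps) $ 1 \<noteq> 0"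
    by (auto simp: fps_deriv_nth)
qed

section \<open>The generating function of the higher-order Euler polynomials\<close>

definition higher_euler_fps :: "nat \<Rightarrow> 'a::field_char_0 \<Rightarrow> 'a fps" where
  "higher_euler_fps p x = (1 - fps_tanh_half) ^ p * fps_exp x"

lemma higher_euler_eq: "higher_euler p n x = fact n * higher_euler_fps p x $ n"
  by (simp add: higher_euler_def higher_euler_fps_def two_div_fps_exp_plus_1)

lemma higher_euler_fps_nth_0: "higher_euler_fps p x $ 0 = 1"
  using nth_less_subdegree_zero[of 0 "fps_tanh_half :: 'a::field_char_0 fps"]
  by (simp add: higher_euler_fps_def subdegree_tanh_half fps_nth_power_0)

text \<open>The logarithmic derivative is x - p u'/(1 - u), and u'/(1 - u) = (1 + u)/2. Induction on
  \<open>p\<close> avoids the division by 1 - u.\<close>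

lemma fps_deriv_higher_euler_fps:
  "fps_deriv (higher_euler_fps p x) =
     (fps_const x - fps_const (of_nat p / 2) * (1 + fps_tanh_half)) * higher_euler_fps p x"
proof (induction p)
  case 0
  show ?case by (simp add: higher_euler_fps_def)
next
  case (Suc p)
  let ?u = "fps_tanh_half :: 'a fps"
  have step: "higher_euler_fps (Suc p) x = (1 - ?u) * higher_euler_fps p x"
    by (simp add: higher_euler_fps_def mult.assoc)
  have c: "fps_const (of_nat (Suc p) / 2 :: 'a) = fps_const (of_nat p / 2) + fps_const (1 / 2)"
    by (simp add: add_divide_distrib)
  show ?case
    unfolding step c fps_deriv_mult Suc.IH
    by (simp only: fps_deriv_sub fps_deriv_1 fps_deriv_tanh_half power2_eq_square) (simp add: algebra_simps del: fps_const_add)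
qed

lemma fps_deriv_higher_euler_fps_tanh_power:
  "fps_deriv (higher_euler_fps p x * fps_tanh_half ^ n) =
     higher_euler_fps p x *
       (fps_const (x - of_nat p / 2) * fps_tanh_half ^ n
        + fps_const (of_nat n / 2) * fps_tanh_half ^ (n - 1)
        - fps_const ((of_nat n + of_nat p) / 2) * fps_tanh_half ^ (n + 1))"
proof -
  define u :: "'a fps" where "u = fps_tanh_half"
  define F where "F = higher_euler_fps p x"
  define a where "a = fps_const x"
  define b :: "'a fps" where "b = fps_const (of_nat p / 2)"
  define c :: "'a fps" where "c = fps_const (of_nat n / 2)"
  have const_eqs: "fps_const (x - of_nat p / 2) = a - b"
    "fps_const ((of_nat n + of_nat p) / 2 :: 'a) = c + b"
    by (simp_all add: a_def b_def c_def add_divide_distrib)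
  have "fps_deriv (u ^ n) = c * (1 - u ^ 2) * u ^ (n - 1)"
    by (simp add: u_def c_def fps_deriv_power fps_deriv_tanh_half flip: mult.assoc)
  also have "\<dots> = c * u ^ (n - 1) - c * u ^ (n + 1)"
  \<comment> \<open>For \<open>n = 0\<close> the exponent \<open>n - 1\<close> is truncated, but
    \<open>c = 0\<close> makes both sides vanish.\<close>
  proof (cases n)
    case (Suc k)
    then show ?thesis by (simp add: power2_eq_square algebra_simps)
  qed (simp add: c_def)
  finally have "fps_deriv (F * u ^ n) =
      F * (c * u ^ (n - 1) - c * u ^ (n + 1)) + (a - b * (1 + u)) * F * u ^ n"
    by (simp add: fps_deriv_higher_euler_fps F_def u_def a_def b_def)
  also have "\<dots> = F * ((a - b) * u ^ n + c * u ^ (n - 1) - (c + b) * u ^ (n + 1))"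
    by (simp add: algebra_simps)
  finally show ?thesis
    by (simp only: const_eqs F_def[symmetric] u_def[symmetric] c_def[symmetric])
qed

section \<open>The polynomials given by the recurrence, and their series\<close>

fun euler_ortho :: "nat \<Rightarrow> 'a::field_char_0 \<Rightarrow> nat \<Rightarrow> 'a poly" where
  "euler_ortho p x 0 = 1"
| "euler_ortho p x (Suc 0) = [:- x + of_nat p / 2, 1:]"
| "euler_ortho p x (Suc (Suc n)) =
     [:- x + of_nat p / 2, 1:] * euler_ortho p x (Suc n) +
     smult (of_nat (Suc n) * (of_nat (Suc n) + of_nat p - 1) / 4) (euler_ortho p x n)"

lemma degree_lead_coeff_euler_ortho:
  "degree (euler_ortho p x n) = n \<and> lead_coeff (euler_ortho p x n) = 1"
proof (induction n rule: induct_nat_012)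
  case (ge2 n)
  let ?l = "[:- x + of_nat p / 2, 1:]"
  let ?q = "smult (of_nat (Suc n) * (of_nat (Suc n) + of_nat p - 1) / 4) (euler_ortho p x n)"
  have nz: "euler_ortho p x (Suc n) \<noteq> 0" using ge2 by auto
  have "degree (?l * euler_ortho p x (Suc n)) = Suc (Suc n)"
    using ge2 nz by (subst degree_mult_eq) auto
  moreover have "lead_coeff (?l * euler_ortho p x (Suc n)) = 1"
    using ge2 by (subst lead_coeff_mult) auto
  moreover have "degree ?q < Suc (Suc n)"
    using ge2 degree_smult_le[of _ "euler_ortho p x n"] by (metis le_imp_less_Suc less_SucI)
  ultimately show ?case
    unfolding euler_ortho.simps
    by (metis degree_add_eq_left lead_coeff_add_le add.commute)
qed simp_all

definition euler_ortho_coeff :: "nat \<Rightarrow> nat \<Rightarrow> 'a::field_char_0" where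
  "euler_ortho_coeff p n = (- 1 / 2) ^ n * pochhammer (of_nat p) n"

lemma umbral_fps_linear_mult:
  "umbral_fps m ([:b, 1:] * q) = fps_deriv (umbral_fps m q) + fps_const b * umbral_fps m q"
  by (simp add: umbral_fps_add umbral_fps_smult umbral_fps_pCons_0)

text \<open>Applying D - x + p/2 to F u^n leaves only the neighbours F u^(n-1) and F u^(n+1). The
  second term of the recurrence cancels the lower one, and the upper one carries the next
  constant.\<close>

lemma umbral_fps_euler_ortho:
  "umbral_fps (\<lambda>k. higher_euler p k x) (euler_ortho p x n) =
     fps_const (euler_ortho_coeff p n) * (higher_euler_fps p x * fps_tanh_half ^ n)"
proof -
  define \<Phi> where "\<Phi> = umbral_fps (\<lambda>k. higher_euler p k x)"
  define F where "F = higher_euler_fps p x"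
  define u :: "'a fps" where "u = fps_tanh_half"
  let ?b = "- x + of_nat p / 2"
  have shift: "fps_deriv (fps_const c * (F * u ^ n)) + fps_const ?b * (fps_const c * (F * u ^ n)) =
      fps_const (c * of_nat n / 2) * (F * u ^ (n - 1))
      - fps_const (c * (of_nat n + of_nat p) / 2) * (F * u ^ (n + 1))" for c n
  proof -
    have const_eqs: "fps_const ?b = - fps_const (x - of_nat p / 2)"
      "fps_const (c * of_nat n / 2) = fps_const c * fps_const (of_nat n / 2)"
      "fps_const (c * (of_nat n + of_nat p) / 2) = fps_const c * fps_const ((of_nat n + of_nat p) / 2)"
      by simp_all
    show ?thesis
      unfolding const_eqs F_def u_def fps_deriv_mult_const_left fps_deriv_higher_euler_fps_tanh_power
      by (simp add: distrib_left right_diff_distrib mult_ac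
          del: fps_const_neg fps_const_add fps_const_sub fps_const_mult)
  qed
  have lin: "\<Phi> ([:?b, 1:] * q) = fps_deriv (\<Phi> q) + fps_const ?b * \<Phi> q" for q
    unfolding \<Phi>_def by (rule umbral_fps_linear_mult)
  have one: "\<Phi> 1 = F"
    unfolding \<Phi>_def higher_euler_eq F_def by (rule umbral_fps_1)
  have "\<Phi> (euler_ortho p x n) = fps_const (euler_ortho_coeff p n) * (F * u ^ n)"
  proof (induction n rule: induct_nat_012)
    case 0
    show ?case by (simp add: one euler_ortho_coeff_def)
  next
    case 1
    show ?case
      using lin[of 1] shift[of 1 0] by (simp add: one euler_ortho_coeff_def flip: fps_const_neg)
  next
    case (ge2 n)
    let ?c = "euler_ortho_coeff p :: nat \<Rightarrow> 'a"
    let ?r = "of_nat (Suc n) * (of_nat (Suc n) + of_nat p - 1) / 4 :: 'a"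
    \<comment> \<open>The factor n (n + p - 1) / 4 of the recurrence originates here: it is n/2
      times (n + p - 1)/2, the latter being minus the ratio of consecutive constants.\<close>
    have "?c (Suc n) * of_nat (Suc n) / 2 + ?r * ?c n = 0"
      by (simp add: euler_ortho_coeff_def pochhammer_Suc field_simps)
    then have cancel: "fps_const (?c (Suc n) * of_nat (Suc n) / 2) = - (fps_const ?r * fps_const (?c n))"
      by (simp add: add_eq_0_iff2)
    have next_c: "- (?c (Suc n) * (of_nat (Suc n) + of_nat p) / 2) = ?c (Suc (Suc n))"
      by (simp add: euler_ortho_coeff_def pochhammer_Suc field_simps)
    have "\<Phi> (euler_ortho p x (Suc (Suc n))) =
        \<Phi> ([:?b, 1:] * euler_ortho p x (Suc n)) + fps_const ?r * \<Phi> (euler_ortho p x n)"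
      unfolding \<Phi>_def euler_ortho.simps umbral_fps_add umbral_fps_smult ..
    also have "\<dots> = - fps_const (?c (Suc n) * (of_nat (Suc n) + of_nat p) / 2) * (F * u ^ Suc (Suc n))"
      unfolding lin ge2 shift cancel
      by (simp add: mult.assoc del: fps_const_neg fps_const_add fps_const_sub fps_const_mult)
    also have "\<dots> = fps_const (?c (Suc (Suc n))) * (F * u ^ Suc (Suc n))"
      by (simp only: fps_const_neg next_c)
    finally show ?case .
  qed
  then show ?thesis by (simp only: \<Phi>_def F_def u_def)
qed

text \<open>Nonvanishing is stated separately because the zero series also has subdegree 0. The
  bound on \<open>p\<close> makes the Pochhammer factor nonzero.\<close>

lemma subdegree_umbral_fps_euler_ortho:
  fixes x :: "'a::field_char_0"
  assumes "p \<ge> 1"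
  shows "umbral_fps (\<lambda>k. higher_euler p k x) (euler_ortho p x n) \<noteq> 0"
    and "subdegree (umbral_fps (\<lambda>k. higher_euler p k x) (euler_ortho p x n)) = n"
proof -
  have c: "euler_ortho_coeff p n \<noteq> (0 :: 'a)"
    using assms pochhammer_pos[of p n] by (simp add: euler_ortho_coeff_def pochhammer_of_nat)
  have F: "higher_euler_fps p x \<noteq> 0" "subdegree (higher_euler_fps p x) = 0"
    using higher_euler_fps_nth_0[of p x] by auto
  have u: "(fps_tanh_half :: 'a fps) \<noteq> 0"
    using subdegree_tanh_half[where 'a = 'a] by auto
  show "umbral_fps (\<lambda>k. higher_euler p k x) (euler_ortho p x n) \<noteq> 0"
    using c F u by (simp add: umbral_fps_euler_ortho)
  show "subdegree (umbral_fps (\<lambda>k. higher_euler p k x) (euler_ortho p x n)) = n"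
    using c F u by (simp add: umbral_fps_euler_ortho subdegree_tanh_half)
qed

theorem theorem1p1:
  fixes p :: nat and x :: "'a::field_char_0" and \<Omega> :: "nat \<Rightarrow> 'a poly"
  assumes "p \<ge> 1"
    and "monic_orthogonal (\<lambda>k. higher_euler p k x) \<Omega>"
  shows "\<Omega> 0 = 1 \<and>
         \<Omega> 1 = [:- x + of_nat p / 2, 1:] \<and>
         (\<forall>n\<ge>1. \<Omega> (n + 1) =
            [:- x + of_nat p / 2, 1:] * \<Omega> n +
            smult (of_nat n * (of_nat n + of_nat p - 1) / 4) (\<Omega> (n - 1)))"
proof -
  let ?m = "\<lambda>k. higher_euler p k x"
  have "monic_orthogonal ?m (euler_ortho p x)"
    using degree_lead_coeff_euler_ortho subdegree_umbral_fps_euler_ortho(2)[OF assms(1)]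
    by (intro monic_orthogonalI_subdegree) blast+
  \<comment> \<open>Up to n! this is the coefficient at the subdegree of a nonzero series.\<close>
  moreover have "umbral_eval ?m (monom 1 n * euler_ortho p x n) \<noteq> 0" for n
    using nth_subdegree_nonzero[OF subdegree_umbral_fps_euler_ortho(1)[OF assms(1), of x n]]
    unfolding subdegree_umbral_fps_euler_ortho(2)[OF assms(1)]
    by (simp add: umbral_fps_def)
  ultimately have \<Omega>: "\<Omega> = euler_ortho p x"
    using monic_orthogonal_unique[OF _ assms(2)] by blast
  have "euler_ortho p x (n + 1) = [:- x + of_nat p / 2, 1:] * euler_ortho p x n +
      smult (of_nat n * (of_nat n + of_nat p - 1) / 4) (euler_ortho p x (n - 1))" if "n \<ge> 1" for n
    using that by (cases n) simp_all
  then show ?thesis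
    unfolding \<Omega> by simp
qed

end
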